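(* Let $\alpha\in\mathbb{R}\setminus\mathbb{Q}$ be equal to a (convergent) signed interlaced continued fraction. Then there exists a Möbius transform of $\alpha$, i.e. a number $\frac{p\alpha+q}{r\alpha+s}$ with $p,q,r,s\in\mathbb{Z}$ and $ps-qr\ne0$, which is equal to a simple interlaced continued fraction.
   Context: For integer sequences $(a_j)_{j\ge1}$, $(b_j)_{j\ge1}$, the continued fraction $$\mathbb{K}_1^\infty\frac{b_j}{a_j}=\cfrac{b_1}{a_1+\cfrac{b_2}{a_2+\cfrac{b_3}{a_3+\cdots}}}$$ is the limit of its convergents $p_N/q_N$, where $p_j=a_jp_{j-1}+b_jp_{j-2}$, $q_j=a_jq_{j-1}+b_jq_{j-2}$ with $p_{-1}=1,\ p_0=0,\ q_{-1}=0,\ q_0=1$. (A leading integer $a_0$ is omitted; it is absorbed into the number $\alpha$.) A signed interlaced continued fraction of period $\beta\ge1$ is such a continued fraction for which there are polynomials $A_1,\dots,A_\beta\in\mathbb{Z}[x]$ and constants $B_1,\dots,B_\beta\in\{1,-1\}$ such that for all $n\ge1$ and $i\in\{1,\dots,\beta\}$, $$a_{(n-1)\beta+i}=A_i(n),\qquad b_{(n-1)\beta+i}=B_i,$$ and $a_j>0$ for all $j\ge1$. A simple interlaced continued fraction is a signed interlaced continued fraction (of some period, not necessarily the same) with all $b_j=1$, i.e. $\mathbb{K}_1^\infty \frac{1}{a_j}$ with $a_{(n-1)\beta+i}=A_i(n)$, $A_i\in\mathbb{Z}[x]$, and $A_i(n)>0$ for all $n\ge1$ and $i\in\{1,\dots,\beta\}$.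 *)

theory Defs
  imports Complex_Main "HOL-Computational_Algebra.Polynomial"
begin

text \<open>
  Sequences \<open>a\<close>, \<open>b\<close> are indexed from 1; their values at 0 are never used.
  To avoid the index \<open>-1\<close>, the recurrences for numerators and denominators are shifted by one:
  \<open>cf_num a b (k + 1)\<close> is $p_k$ and \<open>cf_den a b (k + 1)\<close> is $q_k$, for $k \ge -1$.
\<close>

fun cf_num :: "(nat \<Rightarrow> int) \<Rightarrow> (nat \<Rightarrow> int) \<Rightarrow> nat \<Rightarrow> int" where
  "cf_num a b 0 = 1"
| "cf_num a b (Suc 0) = 0"
| "cf_num a b (Suc (Suc k)) =
     a (Suc k) * cf_num a b (Suc k) + b (Suc k) * cf_num a b k"

fun cf_den :: "(nat \<Rightarrow> int) \<Rightarrow> (nat \<Rightarrow> int) \<Rightarrow> nat \<Rightarrow> int" where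
  "cf_den a b 0 = 0"
| "cf_den a b (Suc 0) = 1"
| "cf_den a b (Suc (Suc k)) =
     a (Suc k) * cf_den a b (Suc k) + b (Suc k) * cf_den a b k"

definition cf_convergent :: "(nat \<Rightarrow> int) \<Rightarrow> (nat \<Rightarrow> int) \<Rightarrow> nat \<Rightarrow> real" where
  "cf_convergent a b N = of_int (cf_num a b (Suc N)) / of_int (cf_den a b (Suc N))"

text \<open>
  For signed continued fractions some denominators may vanish, e.g. $q_2$ for
  $a_1 = a_2 = 1$, $b_2 = -1$. As usual, finitely many undefined convergents are allowed;
  the first conjunct keeps the convention \<open>x / 0 = 0\<close> from influencing the limit.
\<close>

definition cf_converges_to :: "(nat \<Rightarrow> int) \<Rightarrow> (nat \<Rightarrow> int) \<Rightarrow> real \<Rightarrow> bool" where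
  "cf_converges_to a b x \<longleftrightarrow>
     (\<forall>\<^sub>F N in sequentially. cf_den a b (Suc N) \<noteq> 0) \<and>
     cf_convergent a b \<longlonglongrightarrow> x"

definition signed_interlaced :: "nat \<Rightarrow> (nat \<Rightarrow> int) \<Rightarrow> (nat \<Rightarrow> int) \<Rightarrow> bool" where
  "signed_interlaced \<beta> a b \<longleftrightarrow>
     \<beta> \<ge> 1 \<and>
     (\<exists>(A :: nat \<Rightarrow> int poly) (B :: nat \<Rightarrow> int).
        (\<forall>i\<in>{1..\<beta>}. B i \<in> {1, -1}) \<and>
        (\<forall>n\<ge>1. \<forall>i\<in>{1..\<beta>}.
           a ((n - 1) * \<beta> + i) = poly (A i) (int n) \<and> b ((n - 1) * \<beta> + i) = B i)) \<and>
     (\<forall>j\<ge>1. a j > 0)"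

definition simple_interlaced :: "nat \<Rightarrow> (nat \<Rightarrow> int) \<Rightarrow> (nat \<Rightarrow> int) \<Rightarrow> bool" where
  "simple_interlaced \<beta> a b \<longleftrightarrow> signed_interlaced \<beta> a b \<and> (\<forall>j\<ge>1. b j = 1)"

end

theory Submission
  imports Defs
begin

text \<open>
  A continued fraction is an infinite product of integer matrices of determinant \<open>\<plusminus>1\<close>, and replacing
  its value by a Moebius transform corresponds to changing finitely many factors or conjugating. So
  the product of one period of a signed interlaced continued fraction can be manipulated as a cyclic
  word, whose letters consist of a constant matrix \<open>G\<close> and a shear by an integer polynomial \<open>P\<close> in the
  period number. Nothing is lost by such manipulations: when the first columns of unimodular products
  tend to an irrational number, their denominators are unbounded, and therefore the limit does not
  change when the products are multiplied on the right by a fixed unimodular matrix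
  (\<open>column_tends_right\<close>) and then by arbitrary shears. This gives invariance under conjugation and
  in particular under rotation of the word (\<open>represents_conjugate\<close>).

  If \<open>P\<close> is constant or \<open>G\<close> is upper triangular in some letter, two neighbouring letters can be merged
  (\<open>shorten_word\<close>). Hence only two kinds of words matter.

  \<^item> All polynomials are non-constant and no \<open>G\<close> is upper triangular. Then the Euclidean algorithm
  expands each \<open>G\<close> into positive constant partial quotients between two shears by constants. The
  shears are absorbed by the adjacent polynomials, which are made eventually positive by inserting
  sign changes \<open>flip\<close>. Because they are not constant they remain eventually positive whatever
  constants they absorb, so up to finitely many periods the word is a simple interlaced continued
  fraction (\<open>word_has_expansion\<close>, \<open>quot_word_simple_cf\<close>).

  \<^item> A single letter remains. If it is constant, the number is a quadratic irrational, and it is a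
  Moebius transform of an eigenvalue of a matrix of determinant 1 and trace \<open>t\<close> with \<open>\<bar>t\<bar> \<ge> 3\<close>. That
  eigenvalue is related to the periodic continued fraction with partial quotients \<open>1, \<bar>t\<bar> - 2\<close>
  (\<open>constant_word_simple_cf\<close>). If it is upper triangular, the product has no finite limit.
\<close>

section \<open>Integer matrices of size two\<close>

datatype mat2 = Mat (m11: int) (m12: int) (m21: int) (m22: int)

instantiation mat2 :: ring_1
begin
definition "0 = Mat 0 0 0 0"
definition "1 = Mat 1 0 0 1"
definition "A + B = Mat (m11 A + m11 B) (m12 A + m12 B) (m21 A + m21 B) (m22 A + m22 B)"
definition "A - B = Mat (m11 A - m11 B) (m12 A - m12 B) (m21 A - m21 B) (m22 A - m22 B)"
definition "- A = Mat (- m11 A) (- m12 A) (- m21 A) (- m22 A)"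
definition "A * B = Mat (m11 A * m11 B + m12 A * m21 B) (m11 A * m12 B + m12 A * m22 B)
                        (m21 A * m11 B + m22 A * m21 B) (m21 A * m12 B + m22 A * m22 B)"
instance
  by standard (simp_all add: zero_mat2_def one_mat2_def plus_mat2_def minus_mat2_def
      uminus_mat2_def times_mat2_def algebra_simps)
end

lemma mat2_sel [simp]:
  "m11 1 = 1" "m12 1 = 0" "m21 1 = 0" "m22 1 = 1"
  "m11 (- A) = - m11 A" "m12 (- A) = - m12 A" "m21 (- A) = - m21 A" "m22 (- A) = - m22 A"
  "m11 (A * B) = m11 A * m11 B + m12 A * m21 B"
  "m12 (A * B) = m11 A * m12 B + m12 A * m22 B"
  "m21 (A * B) = m21 A * m11 B + m22 A * m21 B"
  "m22 (A * B) = m21 A * m12 B + m22 A * m22 B"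
  by (simp_all add: one_mat2_def uminus_mat2_def times_mat2_def)

lemma mat2_eqI:
  "m11 A = m11 B \<Longrightarrow> m12 A = m12 B \<Longrightarrow> m21 A = m21 B \<Longrightarrow> m22 A = m22 B \<Longrightarrow> A = B"
  by (rule mat2.expand) simp

definition mdet :: "mat2 \<Rightarrow> int" where
  "mdet A = m11 A * m22 A - m12 A * m21 A"

lemma mdet_mult [simp]: "mdet (A * B) = mdet A * mdet B"
  by (simp add: mdet_def algebra_simps)

lemma mdet_one [simp]: "mdet 1 = 1"
  by (simp add: mdet_def)

lemma mdet_uminus [simp]: "mdet (- A) = mdet A"
  by (simp add: mdet_def)

definition unimodular :: "mat2 \<Rightarrow> bool" where
  "unimodular A \<longleftrightarrow> \<bar>mdet A\<bar> = 1"

lemma unimodular_mult [simp]: "unimodular A \<Longrightarrow> unimodular B \<Longrightarrow> unimodular (A * B)"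
  by (simp add: unimodular_def abs_mult)

lemma unimodular_one [simp]: "unimodular 1"
  by (simp add: unimodular_def)

lemma unimodular_uminus [simp]: "unimodular (- A) \<longleftrightarrow> unimodular A"
  by (simp add: unimodular_def)

lemma unimodular_nonzero: "unimodular A \<Longrightarrow> mdet A \<noteq> 0"
  by (auto simp: unimodular_def)

lemma unimodular_left_inverse:
  assumes "unimodular A"
  obtains J where "unimodular J" "J * A = 1"
proof
  have d: "mdet A * mdet A = 1"
    using assms by (auto simp: unimodular_def abs_if split: if_splits)
  define J where "J = Mat (mdet A * m22 A) (- (mdet A * m12 A)) (- (mdet A * m21 A)) (mdet A * m11 A)"
  show "J * A = 1"
    by (rule mat2_eqI) (use d in \<open>auto simp: J_def mdet_def algebra_simps\<close>)
  then have "mdet J * mdet A = 1"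
    by (metis mdet_mult mdet_one)
  then show "unimodular J"
    using assms unfolding unimodular_def by (metis abs_mult abs_one mult.right_neutral)
qed

text \<open>
  These three matrices generate the group of unimodular matrices. Acting on numbers, \<open>shear c\<close>
  adds \<open>c\<close>, \<open>swap\<close> inverts and \<open>flip\<close> negates.
\<close>

definition shear :: "int \<Rightarrow> mat2" where
  "shear c = Mat 1 c 0 1"

definition swap :: mat2 where
  "swap = Mat 0 1 1 0"

definition flip :: mat2 where
  "flip = Mat 1 0 0 (- 1)"

lemma shear_sel [simp]:
  "m11 (shear c) = 1" "m12 (shear c) = c" "m21 (shear c) = 0" "m22 (shear c) = 1"
  by (simp_all add: shear_def)

lemma swap_sel [simp]: "m11 swap = 0" "m12 swap = 1" "m21 swap = 1" "m22 swap = 0"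
  by (simp_all add: swap_def)

lemma flip_sel [simp]: "m11 flip = 1" "m12 flip = 0" "m21 flip = 0" "m22 flip = - 1"
  by (simp_all add: flip_def)

lemma unimodular_shear [simp]: "unimodular (shear c)"
  and unimodular_swap [simp]: "unimodular swap"
  and unimodular_flip [simp]: "unimodular flip"
  by (simp_all add: unimodular_def mdet_def)

lemma shear_0 [simp]: "shear 0 = 1"
  by (simp add: shear_def one_mat2_def)

lemma shear_add: "shear (c + d) = shear c * shear d"
  by (rule mat2_eqI) simp_all

section \<open>The Moebius action on irrational numbers\<close>

definition moebius :: "mat2 \<Rightarrow> real \<Rightarrow> real" where
  "moebius U x = (of_int (m11 U) * x + of_int (m12 U)) / (of_int (m21 U) * x + of_int (m22 U))"

lemma irrational_linear_nonzero:
  fixes x :: real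
  assumes "x \<notin> \<rat>" "(c, d) \<noteq> (0, 0)"
  shows "of_int c * x + of_int d \<noteq> 0"
proof
  assume eq: "of_int c * x + of_int d = 0"
  show False
  proof (cases "c = 0")
    case True
    then show False using eq assms by simp
  next
    case False
    then have "x = - of_int d / of_int c"
      using eq by (simp add: field_simps)
    then show False using assms by auto
  qed
qed

lemma moebius_denominator_nonzero:
  "x \<notin> \<rat> \<Longrightarrow> mdet U \<noteq> 0 \<Longrightarrow> of_int (m21 U) * x + of_int (m22 U) \<noteq> (0::real)"
  by (rule irrational_linear_nonzero) (auto simp: mdet_def)

lemma moebius_mult:
  assumes "x \<notin> \<rat>" "mdet V \<noteq> 0"
  shows "moebius (U * V) x = moebius U (moebius V x)"
proof -
  define n where "n = of_int (m11 V) * x + of_int (m12 V)"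
  define d where "d = of_int (m21 V) * x + of_int (m22 V)"
  have d: "d \<noteq> 0"
    unfolding d_def using assms by (rule moebius_denominator_nonzero)
  have "moebius (U * V) x = (of_int (m11 U) * n + of_int (m12 U) * d) / (of_int (m21 U) * n + of_int (m22 U) * d)"
    by (simp add: moebius_def n_def d_def algebra_simps)
  also have "\<dots> = ((of_int (m11 U) * (n / d) + of_int (m12 U)) * d) / ((of_int (m21 U) * (n / d) + of_int (m22 U)) * d)"
    using d by (simp add: distrib_right)
  also have "\<dots> = moebius U (n / d)"
    using d by (simp add: moebius_def)
  finally show ?thesis
    by (simp add: n_def d_def moebius_def)
qed

lemma moebius_irrational:
  assumes "x \<notin> \<rat>" "mdet U \<noteq> 0"
  shows "moebius U x \<notin> \<rat>"
proof
  define y where "y = moebius U x"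
  assume "moebius U x \<in> \<rat>"
  then have "y \<in> \<rat>" by (simp add: y_def)
  then obtain m k :: int where k: "k \<noteq> 0" and y: "y = of_int m / of_int k"
    by (metis Rats_cases' less_irrefl of_int_0_less_iff)
  have "of_int (m11 U) * x + of_int (m12 U) = y * (of_int (m21 U) * x + of_int (m22 U))"
    using moebius_denominator_nonzero[OF assms] by (simp add: y_def moebius_def)
  then have "of_int (k * m11 U - m * m21 U) * x + of_int (k * m12 U - m * m22 U) = 0"
    using k by (simp add: y field_simps)
  then have z: "k * m11 U - m * m21 U = 0" "k * m12 U - m * m22 U = 0"
    using irrational_linear_nonzero[OF assms(1)] by blast+
  have "k * mdet U = (k * m11 U - m * m21 U) * m22 U - (k * m12 U - m * m22 U) * m21 U"
    by (simp add: mdet_def algebra_simps)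
  then show False
    using z k assms(2) by simp
qed

section \<open>Limits of first columns\<close>

text \<open>
  Only the first column is followed, because it is insensitive to right multiplication by shears.
  A shear may then depend on the position in the product, even with polynomial growth.
\<close>

definition column_tends :: "(nat \<Rightarrow> mat2) \<Rightarrow> real \<Rightarrow> bool" where
  "column_tends X x \<longleftrightarrow> (\<forall>\<^sub>F N in sequentially. m21 (X N) \<noteq> 0) \<and>
     (\<lambda>N. of_int (m11 (X N)) / of_int (m21 (X N))) \<longlonglongrightarrow> x"

lemma column_tends_unique: "column_tends X x \<Longrightarrow> column_tends X y \<Longrightarrow> x = y"
  unfolding column_tends_def by (auto dest: LIMSEQ_unique)

lemma column_tends_cong_ratio:
  assumes "column_tends X x"
    and "\<And>N. (m11 (Y N), m21 (Y N)) = (m11 (X N), m21 (X N)) \<or>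
               (m11 (Y N), m21 (Y N)) = (- m11 (X N), - m21 (X N))"
  shows "column_tends Y x"
proof -
  have "m21 (X N) \<noteq> 0 \<Longrightarrow> m21 (Y N) \<noteq> 0" for N
    using assms(2)[of N] by auto
  moreover have "(of_int (m11 (Y N)) :: real) / of_int (m21 (Y N)) = of_int (m11 (X N)) / of_int (m21 (X N))" for N
    using assms(2)[of N] by auto
  ultimately show ?thesis
    using assms(1) unfolding column_tends_def by (auto elim: eventually_mono)
qed

lemma column_tends_subseq:
  assumes "column_tends X x" "strict_mono f"
  shows "column_tends (\<lambda>N. X (f N)) x"
  using assms unfolding column_tends_def
  by (auto intro: eventually_subseq dest: LIMSEQ_subseq_LIMSEQ simp: o_def)

lemma column_tends_left:
  assumes X: "column_tends X x" and nz: "of_int (m21 U) * x + of_int (m22 U) \<noteq> (0::real)"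
  shows "column_tends (\<lambda>N. U * X N) (moebius U x)"
proof -
  define r where "r N = of_int (m11 (X N)) / (of_int (m21 (X N)) :: real)" for N
  have r: "r \<longlonglongrightarrow> x" and q: "\<forall>\<^sub>F N in sequentially. m21 (X N) \<noteq> 0"
    using X by (auto simp: column_tends_def r_def[abs_def])
  have lim: "(\<lambda>N. of_int (m21 U) * r N + of_int (m22 U)) \<longlonglongrightarrow> of_int (m21 U) * x + of_int (m22 U)"
    by (intro tendsto_intros r)
  then have "\<forall>\<^sub>F N in sequentially. of_int (m21 U) * r N + of_int (m22 U) \<noteq> 0"
    using nz by (rule tendsto_imp_eventually_ne)
  then have ev: "\<forall>\<^sub>F N in sequentially. m21 (X N) \<noteq> 0 \<and> of_int (m21 U) * r N + of_int (m22 U) \<noteq> 0"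
    using q by eventually_elim auto
  have num: "of_int (m11 (U * X N)) = (of_int (m11 U) * r N + of_int (m12 U)) * of_int (m21 (X N))"
    and den: "of_int (m21 (U * X N)) = (of_int (m21 U) * r N + of_int (m22 U)) * of_int (m21 (X N))"
    if "m21 (X N) \<noteq> 0" for N
    using that by (simp_all add: r_def field_simps)
  have "\<forall>\<^sub>F N in sequentially. m21 (U * X N) \<noteq> 0"
    using ev
  proof eventually_elim
    case (elim N)
    then have "of_int (m21 (U * X N)) \<noteq> (0::real)"
      using den[of N] by simp
    then show ?case by (simp only: of_int_eq_0_iff not_False_eq_True)
  qed
  moreover have "(\<lambda>N. of_int (m11 (U * X N)) / of_int (m21 (U * X N))) \<longlonglongrightarrow> moebius U x"
  proof (rule Lim_transform_eventually)
    show "(\<lambda>N. (of_int (m11 U) * r N + of_int (m12 U)) / (of_int (m21 U) * r N + of_int (m22 U))) \<longlonglongrightarrow> moebius U x"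
      unfolding moebius_def by (intro tendsto_intros r nz)
    show "\<forall>\<^sub>F N in sequentially. (of_int (m11 U) * r N + of_int (m12 U)) / (of_int (m21 U) * r N + of_int (m22 U)) =
        of_int (m11 (U * X N)) / of_int (m21 (U * X N))"
      using ev by eventually_elim (simp only: num den mult_divide_mult_cancel_right of_int_eq_0_iff not_False_eq_True)
  qed
  ultimately show ?thesis
    by (simp add: column_tends_def)
qed

lemma column_tends_left_irrational:
  "column_tends X x \<Longrightarrow> x \<notin> \<rat> \<Longrightarrow> mdet U \<noteq> 0 \<Longrightarrow> column_tends (\<lambda>N. U * X N) (moebius U x)"
  using column_tends_left moebius_denominator_nonzero by blast

text \<open>
  Rationals with denominators bounded by \<open>B\<close> become integers after multiplication by \<open>B!\<close>, and
  integers stay away from the non-integer \<open>B! * x\<close>.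
\<close>

lemma column_denominator_unbounded:
  assumes X: "column_tends X x" and x: "x \<notin> \<rat>"
  shows "\<forall>\<^sub>F N in sequentially. B < \<bar>m21 (X N)\<bar>"
proof -
  \<comment> \<open>\<open>K\<close> is a common multiple of all denominators up to \<open>B\<close>.\<close>
  define K :: nat where "K = fact (nat B)"
  have K: "real K > 0" by (simp add: K_def)
  define y where "y = real K * x"
  have "y \<noteq> of_int \<lfloor>y\<rfloor>"
  proof
    assume "y = of_int \<lfloor>y\<rfloor>"
    then have "x = of_int \<lfloor>y\<rfloor> / real K"
      using K by (simp add: y_def field_simps)
    then have "x \<in> \<rat>"
      by (metis Rats_divide Rats_of_int Rats_of_nat)
    then show False using x by simp
  qed
  then have fl: "of_int \<lfloor>y\<rfloor> < y" "y < of_int \<lfloor>y\<rfloor> + 1"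
    by linarith+
  have lim: "(\<lambda>N. real K * (of_int (m11 (X N)) / of_int (m21 (X N)))) \<longlonglongrightarrow> y"
    unfolding y_def using X by (intro tendsto_intros) (simp add: column_tends_def)
  have nz: "\<forall>\<^sub>F N in sequentially. m21 (X N) \<noteq> 0"
    using X by (simp add: column_tends_def)
  show ?thesis
    using order_tendstoD(1)[OF lim fl(1)] order_tendstoD(2)[OF lim fl(2)] nz
  proof eventually_elim
    case (elim N)
    show ?case
    proof (rule ccontr)
      assume "\<not> B < \<bar>m21 (X N)\<bar>"
      then have "nat \<bar>m21 (X N)\<bar> \<le> nat B" "nat \<bar>m21 (X N)\<bar> \<ge> 1"
        using elim(3) by linarith+
      then have "nat \<bar>m21 (X N)\<bar> dvd K"
        unfolding K_def by (intro dvd_fact)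
      then have "m21 (X N) dvd int K"
        by (simp add: nat_dvd_iff)
      then obtain k where k: "int K = m21 (X N) * k" ..
      then have "real K = of_int (m21 (X N)) * of_int k"
        by (metis of_int_mult of_int_of_nat_eq)
      then have "real K * (of_int (m11 (X N)) / of_int (m21 (X N))) = of_int (k * m11 (X N))"
        using elim(3) by simp
      then have "of_int \<lfloor>y\<rfloor> < (of_int (k * m11 (X N)) :: real)"
        "(of_int (k * m11 (X N)) :: real) < of_int (\<lfloor>y\<rfloor> + 1)"
        using elim by simp_all
      then show False by (simp only: of_int_less_iff)
    qed
  qed
qed

text \<open>
  The two columns of a unimodular matrix are coprime vectors with cross product \<open>\<plusminus>1\<close>. Hence the new
  column gives a fraction at distance at most \<open>\<bar>w\<bar> / \<bar>q\<bar>\<close> from the old one, where \<open>q\<close> is the old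
  denominator and \<open>w\<close> is an entry of \<open>V\<close>, provided the new denominator is not zero. If it is zero,
  coprimality forces \<open>q\<close> to divide \<open>w\<close>. Both points are settled by \<open>\<bar>q\<bar> \<longlongrightarrow> \<infinity>\<close>.
\<close>

lemma column_tends_right:
  assumes X: "column_tends X x" and x: "x \<notin> \<rat>" and uX: "\<And>N. unimodular (X N)"
    and V: "unimodular V"
  shows "column_tends (\<lambda>N. X N * V) x"
proof -
  define v where "v = m11 V"
  define w where "w = m21 V"
  have vw: "v \<noteq> 0 \<or> w \<noteq> 0"
    using unimodular_nonzero[OF V] by (auto simp: mdet_def v_def w_def)
  define P where "P N = m11 (X N) * v + m12 (X N) * w" for N
  define Q where "Q N = m21 (X N) * v + m22 (X N) * w" for N
  define r where "r N = of_int (m11 (X N)) / (of_int (m21 (X N)) :: real)" for N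
  have r: "r \<longlonglongrightarrow> x"
    using X by (auto simp: column_tends_def r_def[abs_def])
  have cross: "P N * m21 (X N) - m11 (X N) * Q N = - w * mdet (X N)" for N
    by (simp add: P_def Q_def mdet_def algebra_simps)
  have Q0: "Q N \<noteq> 0" if "\<bar>w\<bar> < \<bar>m21 (X N)\<bar>" for N
  proof
    assume "Q N = 0"
    then have "P N * m21 (X N) = - w * mdet (X N)"
      using cross[of N] by simp
    then have "m21 (X N) dvd w * mdet (X N)"
      by (metis dvd_minus_iff dvd_triv_right minus_mult_left)
    then have "m21 (X N) dvd w"
      using uX[of N] by (auto simp: unimodular_def abs_if split: if_splits)
    then have "w = 0"
      using that by (meson dvd_imp_le_int not_le)
    then show False
      using \<open>Q N = 0\<close> vw that by (auto simp: Q_def)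
  qed
  have ev: "\<forall>\<^sub>F N in sequentially. \<bar>w\<bar> < \<bar>m21 (X N)\<bar>"
    using X x by (rule column_denominator_unbounded)
  have diff: "\<bar>of_int (P N) / of_int (Q N) - r N\<bar> \<le> \<bar>of_int w\<bar> / \<bar>of_int (m21 (X N))\<bar>"
    if "\<bar>w\<bar> < \<bar>m21 (X N)\<bar>" for N
  proof -
    have q: "m21 (X N) \<noteq> 0" and Q: "Q N \<noteq> 0"
      using that Q0 by auto
    have "of_int (P N) / of_int (Q N) - r N = of_int (P N * m21 (X N) - m11 (X N) * Q N) / (of_int (Q N) * of_int (m21 (X N)))"
      using q Q by (simp add: r_def field_simps)
    then have "\<bar>of_int (P N) / of_int (Q N) - r N\<bar> = \<bar>of_int w\<bar> / (\<bar>of_int (Q N)\<bar> * \<bar>of_int (m21 (X N))\<bar>)"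
      using uX[of N] unfolding cross
      by (simp add: abs_mult unimodular_def flip: of_int_abs)
    also have "\<dots> \<le> \<bar>of_int w\<bar> / (1 * \<bar>of_int (m21 (X N))\<bar>)"
      using q Q by (intro divide_left_mono mult_right_mono) (auto simp flip: of_int_abs)
    finally show ?thesis by simp
  qed
  have "(\<lambda>N. of_int (P N) / of_int (Q N) - r N) \<longlonglongrightarrow> 0"
  proof (rule LIMSEQ_I)
    fix e :: real assume e: "e > 0"
    obtain B :: int where B: "\<bar>of_int w\<bar> / e < of_int B"
      using ex_less_of_int by blast
    have "\<forall>\<^sub>F N in sequentially. norm (of_int (P N) / of_int (Q N) - r N - 0) < e"
      using ev column_denominator_unbounded[OF X x, of B]
    proof eventually_elim
      case (elim N)
      have "\<bar>of_int w\<bar> / e < of_int \<bar>m21 (X N)\<bar>"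
        using B elim(2) by linarith
      then have "\<bar>of_int w\<bar> / \<bar>of_int (m21 (X N))\<bar> < e"
        using e elim(1) by (simp add: field_simps)
      then show ?case using diff[OF elim(1)] by simp
    qed
    then show "\<exists>no. \<forall>n\<ge>no. norm (of_int (P n) / of_int (Q n) - r n - 0) < e"
      by (simp add: eventually_sequentially)
  qed
  then have "(\<lambda>N. (of_int (P N) / of_int (Q N) - r N) + r N) \<longlonglongrightarrow> 0 + x"
    using r by (rule tendsto_add)
  moreover have "\<forall>\<^sub>F N in sequentially. Q N \<noteq> 0"
    using ev by eventually_elim (rule Q0)
  ultimately show ?thesis
    by (simp add: column_tends_def P_def Q_def v_def w_def)
qed

section \<open>Numbers represented by matrix products\<close>

fun mprod :: "(nat \<Rightarrow> mat2) \<Rightarrow> nat \<Rightarrow> mat2" where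
  "mprod F 0 = 1"
| "mprod F (Suc N) = mprod F N * F N"

lemma mprod_add: "mprod F (m + N) = mprod F m * mprod (\<lambda>n. F (m + n)) N"
  by (induction N) (simp_all add: mult.assoc)

lemma mprod_prod_list: "mprod F N = prod_list (map F [0..<N])"
  by (induction N) simp_all

lemma mprod_blocks:
  "mprod F (N * k) = mprod (\<lambda>n. prod_list (map (\<lambda>i. F (n * k + i)) [0..<k])) N"
proof (induction N)
  case (Suc N)
  have "mprod F (Suc N * k) = mprod F (N * k + k)"
    by (simp add: add.commute)
  then show ?case
    using Suc by (simp add: mprod_add mprod_prod_list[where N = k])
qed simp

lemma unimodular_mprod: "(\<And>n. unimodular (F n)) \<Longrightarrow> unimodular (mprod F N)"
  by (induction N) simp_all

lemma mprod_const_commute: "mprod (\<lambda>_. K) (Suc N) = K * mprod (\<lambda>_. K) N"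
  by (induction N) (simp_all add: mult.assoc)

text \<open>
  Matrices that differ by a sign act equally on numbers.
\<close>

definition sign_eq :: "mat2 \<Rightarrow> mat2 \<Rightarrow> bool"  (infix "\<approx>" 50) where
  "A \<approx> B \<longleftrightarrow> A = B \<or> A = - B"

lemma sign_eq_refl [simp]: "A \<approx> A"
  by (simp add: sign_eq_def)

lemma sign_eq_sym: "A \<approx> B \<Longrightarrow> B \<approx> A"
  by (auto simp: sign_eq_def)

lemma sign_eq_trans [trans]: "A \<approx> B \<Longrightarrow> B \<approx> C \<Longrightarrow> A \<approx> C"
  by (auto simp: sign_eq_def)

lemma sign_eq_mult: "A \<approx> B \<Longrightarrow> C \<approx> D \<Longrightarrow> A * C \<approx> B * D"
  by (auto simp: sign_eq_def)

lemma column_tends_sign_shear: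
  assumes X: "column_tends X x" and Y: "\<And>N. Y N \<approx> X N * shear (h N)"
  shows "column_tends Y x"
  using X
proof (rule column_tends_cong_ratio)
  fix N
  consider "Y N = X N * shear (h N)" | "Y N = - (X N * shear (h N))"
    using Y[of N] by (auto simp: sign_eq_def)
  then show "(m11 (Y N), m21 (Y N)) = (m11 (X N), m21 (X N)) \<or>
      (m11 (Y N), m21 (Y N)) = (- m11 (X N), - m21 (X N))"
    by cases simp_all
qed

text \<open>
  Left factors of the product are absorbed into the Moebius transform \<open>U\<close>; this makes the notion
  invariant under dropping initial factors and under conjugation.
\<close>

definition represents :: "(nat \<Rightarrow> mat2) \<Rightarrow> real \<Rightarrow> bool" where
  "represents F \<alpha> \<longleftrightarrow> (\<forall>n. unimodular (F n)) \<and>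
     (\<exists>U. mdet U \<noteq> 0 \<and> column_tends (mprod F) (moebius U \<alpha>))"

text \<open>
  Both the rotation of a word and the passage to its expansion are instances of this telescoping
  argument. The constant part
  \<open>H\<close> of the conjugating matrix is harmless on the right because the first column of the product
  tends to an irrational number, and the varying part is harmless because it is a shear.
\<close>

lemma represents_conjugate:
  assumes irr: "\<alpha> \<notin> \<rat>" and F: "represents F \<alpha>"
    and F': "\<And>n. unimodular (F' n)" and H: "unimodular H"
    and conj: "\<And>n. F n * (H * shear (h (Suc n))) \<approx> (H * shear (h n)) * F' n"
  shows "represents F' \<alpha>"
proof -
  obtain U where U: "mdet U \<noteq> 0" and lim: "column_tends (mprod F) (moebius U \<alpha>)"
    and uF: "\<And>n. unimodular (F n)"
    using F by (auto simp: represents_def)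
  have tele: "mprod F N * (H * shear (h N)) \<approx> (H * shear (h 0)) * mprod F' N" for N
  proof (induction N)
    case (Suc N)
    have "mprod F (Suc N) * (H * shear (h (Suc N))) = mprod F N * (F N * (H * shear (h (Suc N))))"
      by (simp add: mult.assoc)
    also have "\<dots> \<approx> mprod F N * ((H * shear (h N)) * F' N)"
      by (intro sign_eq_mult conj sign_eq_refl)
    also have "\<dots> = (mprod F N * (H * shear (h N))) * F' N"
      by (simp add: mult.assoc)
    also have "\<dots> \<approx> ((H * shear (h 0)) * mprod F' N) * F' N"
      by (intro sign_eq_mult Suc.IH sign_eq_refl)
    finally show ?case by (simp add: mult.assoc)
  qed simp
  obtain J where J: "unimodular J" "J * (H * shear (h 0)) = 1"
    using unimodular_left_inverse[of "H * shear (h 0)"] H by auto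
  have irrU: "moebius U \<alpha> \<notin> \<rat>"
    using irr U by (rule moebius_irrational)
  have "column_tends (\<lambda>N. J * (mprod F N * H)) (moebius J (moebius U \<alpha>))"
    by (intro column_tends_left_irrational column_tends_right lim irrU unimodular_mprod uF H
        unimodular_nonzero J)
  moreover have "mprod F' N \<approx> J * (mprod F N * H) * shear (h N)" for N
  proof -
    have "mprod F' N = J * ((H * shear (h 0)) * mprod F' N)"
      using J(2) by (simp flip: mult.assoc)
    also have "\<dots> \<approx> J * (mprod F N * (H * shear (h N)))"
      by (intro sign_eq_mult sign_eq_refl sign_eq_sym[OF tele])
    finally show ?thesis by (simp add: mult.assoc)
  qed
  ultimately have "column_tends (mprod F') (moebius J (moebius U \<alpha>))"
    by (rule column_tends_sign_shear)
  then show ?thesis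
    using F' U J irr unimodular_nonzero[OF J(1)] unfolding represents_def
    by (intro conjI allI exI[of _ "J * U"]) (simp_all add: moebius_mult)
qed

lemma represents_shift:
  assumes irr: "\<alpha> \<notin> \<rat>" and F: "represents F \<alpha>"
  shows "represents (\<lambda>n. F (m + n)) \<alpha>"
proof -
  obtain U where U: "mdet U \<noteq> 0" and lim: "column_tends (mprod F) (moebius U \<alpha>)"
    and uF: "\<And>n. unimodular (F n)"
    using F by (auto simp: represents_def)
  obtain J where J: "unimodular J" "J * mprod F m = 1"
    using unimodular_left_inverse[of "mprod F m"] unimodular_mprod[of F m] uF by auto
  have "column_tends (\<lambda>N. mprod F (m + N)) (moebius U \<alpha>)"
    using column_tends_subseq[OF lim, of "\<lambda>N. m + N"] by (simp add: strict_mono_def)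
  then have "column_tends (\<lambda>N. J * mprod F (m + N)) (moebius J (moebius U \<alpha>))"
    by (intro column_tends_left_irrational moebius_irrational irr U unimodular_nonzero J)
  moreover have "J * mprod F (m + N) = mprod (\<lambda>n. F (m + n)) N" for N
    using J(2) by (simp add: mprod_add flip: mult.assoc)
  ultimately have "column_tends (mprod (\<lambda>n. F (m + n))) (moebius J (moebius U \<alpha>))"
    by simp
  then show ?thesis
    using uF U J irr unimodular_nonzero[OF J(1)] unfolding represents_def
    by (intro conjI allI exI[of _ "J * U"]) (simp_all add: moebius_mult)
qed

text \<open>
  Such products keep the denominator zero.
\<close>

lemma represents_not_upper_triangular:
  assumes "represents F \<alpha>" "\<And>n. m21 (F n) = 0"
  shows False
proof -
  have "m21 (mprod F N) = 0" for N
    using assms(2) by (induction N) simp_all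
  then show False
    using assms(1) by (auto simp: represents_def column_tends_def)
qed

section \<open>Convergents as matrix products\<close>

text \<open>
  The matrix of the map \<open>x \<mapsto> c + 1 / x\<close>, which is one step of a simple continued fraction with
  partial quotient \<open>c\<close>.
\<close>

definition quot :: "int \<Rightarrow> mat2" where
  "quot c = Mat c 1 1 0"

lemma quot_sel [simp]: "m11 (quot c) = c" "m12 (quot c) = 1" "m21 (quot c) = 1" "m22 (quot c) = 0"
  by (simp_all add: quot_def)

lemma shear_swap: "shear c * swap = quot c"
  by (rule mat2_eqI) simp_all

lemma unimodular_quot [simp]: "unimodular (quot c)"
  by (simp add: unimodular_def mdet_def)

definition convergent_matrix :: "(nat \<Rightarrow> int) \<Rightarrow> (nat \<Rightarrow> int) \<Rightarrow> nat \<Rightarrow> mat2" where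
  "convergent_matrix a b N =
     Mat (cf_num a b (Suc N)) (cf_num a b N) (cf_den a b (Suc N)) (cf_den a b N)"

lemma convergent_matrix_eq:
  "convergent_matrix a b N = swap * mprod (\<lambda>j. Mat (a (Suc j)) 1 (b (Suc j)) 0) N"
proof (induction N)
  case 0
  show ?case by (rule mat2_eqI) (simp_all add: convergent_matrix_def)
next
  case (Suc N)
  have "convergent_matrix a b (Suc N) = convergent_matrix a b N * Mat (a (Suc N)) 1 (b (Suc N)) 0"
    by (rule mat2_eqI) (simp_all add: convergent_matrix_def algebra_simps)
  then show ?case using Suc by (simp add: mult.assoc)
qed

lemma cf_converges_to_iff: "cf_converges_to a b x \<longleftrightarrow> column_tends (convergent_matrix a b) x"
  by (simp add: cf_converges_to_def column_tends_def convergent_matrix_def cf_convergent_def[abs_def])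

text \<open>
  Consecutive convergents differ by \<open>1 / (q * q')\<close> in absolute value, where \<open>q\<close> and \<open>q'\<close> are
  the successive denominators, and the denominators grow at least linearly. So the differences are
  dominated by a telescoping series.
\<close>

lemma simple_cf_converges:
  assumes a: "\<And>j. j \<ge> 1 \<Longrightarrow> a j \<ge> 1" and b: "\<And>j. j \<ge> 1 \<Longrightarrow> b j = 1"
  obtains L where "L \<ge> 0" "cf_converges_to a b L"
proof -
  have den_pos: "cf_den a b (Suc k) \<ge> 1 \<and> cf_den a b k \<ge> 0" for k
  proof (induction k)
    case (Suc k)
    have "1 * cf_den a b (Suc k) \<le> a (Suc k) * cf_den a b (Suc k)"
      using Suc a by (intro mult_right_mono) auto
    then have "1 \<le> a (Suc k) * cf_den a b (Suc k) + cf_den a b k"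
      using Suc by linarith
    then show ?case using Suc b[of "Suc k"] by simp
  qed simp
  have num_nonneg: "cf_num a b (Suc k) \<ge> 0 \<and> cf_num a b k \<ge> 0" for k
  proof (induction k)
    case (Suc k)
    then show ?case using b[of "Suc k"] a[of "Suc k"] by simp
  qed simp
  have den_step: "cf_den a b (Suc (Suc k)) \<ge> cf_den a b (Suc k) + cf_den a b k" for k
  proof -
    have "cf_den a b (Suc k) * 1 \<le> cf_den a b (Suc k) * a (Suc k)"
      using den_pos[of k] a by (intro mult_left_mono) auto
    then show ?thesis using b[of "Suc k"] by (simp add: mult.commute)
  qed
  have den_ge: "int k \<le> cf_den a b (Suc k)" for k
  proof (induction k)
    case (Suc k)
    show ?case
    proof (cases k)
      case 0
      then show ?thesis using den_pos[of 1] by simp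
    next
      case (Suc k')
      then show ?thesis using den_step[of k] den_pos[of k'] \<open>int k \<le> cf_den a b (Suc k)\<close> by simp
    qed
  qed simp
  define c where "c = cf_convergent a b"
  have um: "unimodular (convergent_matrix a b N)" for N
    unfolding convergent_matrix_eq using b
    by (intro unimodular_mult unimodular_swap unimodular_mprod) (simp add: unimodular_def mdet_def)
  have diff: "norm (c (Suc (Suc k)) - c (Suc k)) \<le> inverse (real (Suc k)) - inverse (real (Suc (Suc k)))" for k
  proof -
    define p p' q q' where "p = cf_num a b (Suc (Suc k))" "p' = cf_num a b (Suc (Suc (Suc k)))"
      "q = cf_den a b (Suc (Suc k))" "q' = cf_den a b (Suc (Suc (Suc k)))"
    note defs = this
    have "\<bar>p' * q - p * q'\<bar> = 1"
      using um[of "Suc (Suc k)"] unfolding convergent_matrix_def defs unimodular_def mdet_def mat2.sel .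
    then have num: "\<bar>of_int p' * of_int q - of_int p * of_int q'\<bar> = (1::real)"
      by (metis of_int_1 of_int_abs of_int_diff of_int_mult)
    have q: "int (Suc k) \<le> q" "int (Suc (Suc k)) \<le> q'"
      using den_ge[of "Suc k"] den_ge[of "Suc (Suc k)"] unfolding defs by linarith+
    then have q_r: "real (Suc k) \<le> of_int q" "real (Suc (Suc k)) \<le> of_int q'"
      by linarith+
    then have pos: "of_int q > (0::real)" "of_int q' > (0::real)" by linarith+
    have "c (Suc (Suc k)) - c (Suc k) = (of_int p' * of_int q - of_int p * of_int q') / (of_int q' * of_int q)"
      using pos unfolding c_def cf_convergent_def defs by (subst diff_frac_eq) auto
    then have "norm (c (Suc (Suc k)) - c (Suc k)) = 1 / (of_int q' * of_int q)"
      using num pos by simp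
    also have "\<dots> \<le> 1 / (real (Suc (Suc k)) * real (Suc k))"
      using q_r pos by (intro divide_left_mono mult_mono mult_pos_pos) auto
    also have "\<dots> = inverse (real (Suc k)) - inverse (real (Suc (Suc k)))"
      by (simp add: field_simps)
    finally show ?thesis .
  qed
  have "summable (\<lambda>k. c (Suc (Suc k)) - c (Suc k))"
  proof (rule summable_comparison_test')
    show "summable (\<lambda>k. inverse (real (Suc k)) - inverse (real (Suc (Suc k))))"
      using telescope_summable'[OF LIMSEQ_inverse_real_of_nat] .
  qed (use diff in blast)
  then have "convergent (\<lambda>n. \<Sum>k<n. c (Suc (Suc k)) - c (Suc k))"
    by (simp add: summable_iff_convergent)
  then have "convergent (\<lambda>n. c (Suc n) - c (Suc 0))"
    using sum_lessThan_telescope[of "\<lambda>k. c (Suc k)"] by simp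
  then obtain l where "(\<lambda>n. c (Suc n) - c (Suc 0)) \<longlonglongrightarrow> l"
    by (auto simp: convergent_def)
  then have "(\<lambda>n. (c (Suc n) - c (Suc 0)) + c (Suc 0)) \<longlonglongrightarrow> l + c (Suc 0)"
    by (intro tendsto_intros)
  then have lim: "c \<longlonglongrightarrow> l + c (Suc 0)"
    by (simp add: filterlim_sequentially_Suc)
  show thesis
  proof
    have "c n \<ge> 0" for n
      using num_nonneg[of n] den_pos[of n] by (simp add: c_def cf_convergent_def)
    then show "l + c (Suc 0) \<ge> 0"
      using lim by (intro LIMSEQ_le_const[OF lim]) auto
    have "cf_den a b (Suc N) \<noteq> 0" for N
      using den_pos[of N] by linarith
    then show "cf_converges_to a b (l + c (Suc 0))"
      using lim by (simp add: cf_converges_to_def c_def)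
  qed
qed

section \<open>Words with polynomial shears\<close>

text \<open>
  A letter \<open>(G, P)\<close> stands for the matrices \<open>G * shear (P n)\<close>, and a word for their products, one
  product for every period \<open>n\<close>. Unlike a sequence of partial quotients, this form does not restrict
  the signs of the polynomials, so it is stable under all manipulations below.
\<close>

type_synonym letter = "mat2 \<times> int poly"

definition letter_at :: "nat \<Rightarrow> letter \<Rightarrow> mat2" where
  "letter_at n l = fst l * shear (poly (snd l) (int n))"

definition word_at :: "letter list \<Rightarrow> nat \<Rightarrow> mat2" where
  "word_at w n = prod_list (map (letter_at n) w)"

definition unimodular_word :: "letter list \<Rightarrow> bool" where
  "unimodular_word w \<longleftrightarrow> (\<forall>l\<in>set w. unimodular (fst l))"

text \<open>
  Moving a letter across the period boundary shifts its index by one.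
\<close>

definition next_letter :: "letter \<Rightarrow> letter" where
  "next_letter l = (fst l, pcompose (snd l) [:1, 1:])"

lemma letter_at_next [simp]: "letter_at n (next_letter l) = letter_at (Suc n) l"
  by (simp add: letter_at_def next_letter_def poly_pcompose add.commute)

lemma word_at_simps [simp]:
  "word_at [] n = 1" "word_at (l # w) n = letter_at n l * word_at w n"
  "word_at (u @ v) n = word_at u n * word_at v n"
  by (simp_all add: word_at_def)

lemma unimodular_word_simps [simp]:
  "unimodular_word []"
  "unimodular_word (l # w) \<longleftrightarrow> unimodular (fst l) \<and> unimodular_word w"
  "unimodular_word (u @ v) \<longleftrightarrow> unimodular_word u \<and> unimodular_word v"
  "unimodular_word (map next_letter w) \<longleftrightarrow> unimodular_word w"
  by (auto simp: unimodular_word_def next_letter_def)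

lemma unimodular_word_at: "unimodular_word w \<Longrightarrow> unimodular (word_at w n)"
  by (induction w) (auto simp: letter_at_def)

lemma represents_rotate1:
  assumes "\<alpha> \<notin> \<rat>" "represents (word_at (l # u)) \<alpha>" "unimodular_word (l # u)"
  shows "represents (word_at (u @ [next_letter l])) \<alpha>"
proof (rule represents_conjugate[OF assms(1,2)])
  show "unimodular (word_at (u @ [next_letter l]) n)" for n
    using assms(3) by (intro unimodular_word_at) (simp add: next_letter_def)
  show "unimodular (fst l)"
    using assms(3) by simp
  show "word_at (l # u) n * (fst l * shear (poly (snd l) (int (Suc n)))) \<approx>
      (fst l * shear (poly (snd l) (int n))) * word_at (u @ [next_letter l]) n" for n
    by (simp add: letter_at_def[of _ l] mult.assoc)
qed

lemma represents_rotate: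
  assumes "\<alpha> \<notin> \<rat>" "represents (word_at (u @ v)) \<alpha>" "unimodular_word (u @ v)"
  shows "represents (word_at (v @ map next_letter u)) \<alpha>"
  using assms(2,3)
proof (induction u arbitrary: v)
  case (Cons l u)
  have "represents (word_at (l # (u @ v))) \<alpha>" "unimodular_word (l # (u @ v))"
    using Cons.prems by (simp_all only: append_Cons)
  then have "represents (word_at ((u @ v) @ [next_letter l])) \<alpha>"
    by (rule represents_rotate1[OF assms(1)])
  moreover have "unimodular_word (u @ v @ [next_letter l])"
    using Cons.prems by (simp add: next_letter_def)
  ultimately show ?case
    using Cons.IH[of "v @ [next_letter l]"] by (simp only: append_assoc append_Cons append_Nil list.map)
qed simp

text \<open>
  Both diagonal entries of \<open>H\<close> are \<open>\<plusminus>1\<close>, so conjugation by \<open>H\<close> multiplies the parameter of a shear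
  by \<open>\<plusminus>1\<close>.
\<close>

lemma upper_triangular_past_shear:
  assumes "unimodular H" "m21 H = 0"
  shows "shear p * H = H * shear (m11 H * m22 H * p)"
proof -
  have "\<bar>m11 H\<bar> * \<bar>m22 H\<bar> = 1"
    using assms by (simp add: unimodular_def mdet_def abs_mult)
  then have "\<bar>m11 H\<bar> = 1"
    by (simp add: zmult_eq_1_iff abs_if split: if_splits)
  then have "m11 H * m11 H = 1"
    by (auto simp: abs_if split: if_splits)
  then have "m11 H * (m11 H * m22 H * p) = m22 H * p"
    by (simp flip: mult.assoc)
  then show ?thesis
    using assms(2) by (intro mat2_eqI) (simp_all add: mult.commute)
qed

lemma poly_degree_0: "degree P = 0 \<Longrightarrow> poly P x = coeff P 0"
  by (auto elim: degree_eq_zeroE)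

text \<open>
  A letter with a constant polynomial is a constant matrix and can be absorbed into the matrix part
  of its successor. A letter with an upper triangular matrix part lets the shear of its predecessor
  pass through, and the two shears become one. A rotation of the word provides the required
  neighbour.
\<close>

lemma shorten_word:
  assumes irr: "\<alpha> \<notin> \<rat>" and w: "represents (word_at w) \<alpha>" "unimodular_word w"
    and l: "l \<in> set w" "degree (snd l) = 0 \<or> m21 (fst l) = 0" and len: "length w \<ge> 2"
  obtains w' where "represents (word_at w') \<alpha>" "unimodular_word w'" "length w' < length w"
proof -
  obtain u v where uv: "w = u @ l # v"
    using split_list[OF l(1)] by blast
  define z where "z = v @ map next_letter u"
  have z: "represents (word_at (l # z)) \<alpha>" "unimodular_word (l # z)"
    using represents_rotate[OF irr, of u "l # v"] w by (auto simp: uv z_def)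
  have len_z: "length z = length w - 1" "z \<noteq> []"
    using len by (auto simp: uv z_def)
  show thesis
    using l(2)
  proof
    assume deg: "degree (snd l) = 0"
    obtain m r where m: "z = m # r"
      using len_z by (cases z) auto
    \<comment> \<open>Since \<open>l\<close> is constant, its value at 0 is its value everywhere.\<close>
    define w' where "w' = (letter_at 0 l * fst m, snd m) # r"
    have const: "letter_at n l = letter_at 0 l" for n
      using deg by (simp add: letter_at_def poly_degree_0)
    have "word_at w' = word_at (l # z)"
    proof
      fix n
      show "word_at w' n = word_at (l # z) n"
        using const[of n] by (simp add: w'_def m letter_at_def[of n m] letter_at_def[of n "(_, _)"] mult.assoc)
    qed
    then show thesis
      using z len_z len by (intro that[of w']) (auto simp: w'_def m letter_at_def)
  next
    assume tri: "m21 (fst l) = 0"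
    obtain r m where m: "z = r @ [m]"
      using len_z by (cases z rule: rev_cases) auto
    define e where "e = m11 (fst l) * m22 (fst l)"
    \<comment> \<open>One more rotation puts the triangular letter behind its predecessor \<open>m\<close>.\<close>
    define k where "k = next_letter l"
    define w' where "w' = r @ [(fst m * fst k, smult e (snd m) + snd k)]"
    have "letter_at n m * letter_at n k = letter_at n (fst m * fst k, smult e (snd m) + snd k)" for n
    proof -
      have "shear (poly (snd m) (int n)) * fst k = fst k * shear (e * poly (snd m) (int n))"
        using z(2) tri unfolding e_def by (simp add: upper_triangular_past_shear k_def next_letter_def)
      then show ?thesis
        by (simp add: letter_at_def shear_add mult.assoc flip: mult.assoc[of "shear _" "fst k"])
    qed
    then have "word_at w' = word_at (z @ [k])"
      by (auto simp: w'_def m mult.assoc)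
    moreover have "represents (word_at (z @ [k])) \<alpha>"
      unfolding k_def using represents_rotate1[OF irr z] .
    ultimately show thesis
      using z len_z len by (intro that[of w']) (auto simp: w'_def m k_def next_letter_def)
  qed
qed

section \<open>Continued fraction expansion of a unimodular matrix\<close>

text \<open>
  This is the Euclidean algorithm on the first column of \<open>G\<close>. The determinant has to come out right:
  when the algorithm stops with a remaining factor of determinant \<open>-1\<close>, the last partial quotient
  \<open>c\<close> is replaced by \<open>c - 1\<close> followed by \<open>1\<close>. The condition \<open>m11 G > m21 G\<close> propagates the positivity
  of the quotients after the first one.
\<close>

lemma expand_unimodular_pos:
  assumes "unimodular G" "m21 G > 0"
  shows "\<exists>c cs t. (\<forall>d\<in>set cs. d \<ge> 1) \<and> (m11 G > m21 G \<longrightarrow> c \<ge> 1) \<and>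
           G = shear c * swap * prod_list (map quot cs) * shear t"
  using assms
proof (induction "nat (m21 G)" arbitrary: G rule: less_induct)
  case less
  define r where "r = m21 G"
  define c where "c = m11 G div r"
  define G' where "G' = swap * shear (- c) * G"
  have r: "r > 0" using less.prems by (simp add: r_def)
  have G'_entries: "m11 G' = r" "m21 G' = m11 G mod r"
    by (simp_all add: G'_def r_def c_def minus_mult_div_eq_mod mult.commute algebra_simps)
  have G: "G = shear c * swap * G'"
    by (rule mat2_eqI) (simp_all add: G'_def)
  have uG': "unimodular G'"
    using less.prems by (simp add: G'_def)
  have c1: "c \<ge> 1" if "m11 G > r"
    using that r unfolding c_def by (simp add: pos_imp_zdiv_pos_iff int_one_le_iff_zero_less)
  show ?case
  proof (cases "m21 G' = 0")
    case False
    then have pos: "m21 G' > 0" and small: "m21 G' < r"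
      using r pos_mod_bound[of r "m11 G"] pos_mod_sign[of r "m11 G"] unfolding G'_entries by linarith+
    have "nat (m21 G') < nat (m21 G)"
      using pos small r by (simp add: r_def)
    then obtain c' cs t where IH: "\<forall>d\<in>set cs. d \<ge> 1" "m11 G' > m21 G' \<longrightarrow> c' \<ge> 1"
      "G' = shear c' * swap * prod_list (map quot cs) * shear t"
      using less.hyps[OF _ uG' pos] by blast
    have "G = shear c * swap * prod_list (map quot (c' # cs)) * shear t"
      unfolding G by (subst IH(3)) (simp add: mult.assoc flip: shear_swap)
    then show ?thesis
      using IH small c1 unfolding G'_entries r_def
      by (intro exI[of _ c] exI[of _ "c' # cs"] exI[of _ t]) (auto simp: r_def)
  next
    case True
    then have "\<bar>r\<bar> * \<bar>m22 G'\<bar> = 1"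
      using uG' by (simp add: unimodular_def mdet_def abs_mult G'_entries)
    then have r1: "r = 1" and "\<bar>m22 G'\<bar> = 1"
      using r by (auto simp: zmult_eq_1_iff)
    then consider "m22 G' = 1" | "m22 G' = - 1" by linarith
    then show ?thesis
    proof cases
      case 1
      then have "G' = shear (m12 G')"
        using True r1 by (intro mat2_eqI) (simp_all add: G'_entries)
      then have "G = shear c * swap * prod_list (map quot []) * shear (m12 G')"
        using G by simp
      then show ?thesis
        using c1 by (intro exI[of _ c] exI[of _ "[]"] exI[of _ "m12 G'"]) (auto simp: r_def)
    next
      case 2
      have "G = shear (c - 1) * swap * prod_list (map quot [1]) * shear (m12 G' - 1)"
        unfolding G by (rule mat2_eqI) (use 2 True r1 in \<open>simp_all add: G'_entries algebra_simps\<close>)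
      moreover have "c - 1 \<ge> 1" if "m11 G > m21 G"
        using that r1 by (simp add: c_def flip: r_def)
      ultimately show ?thesis
        by (intro exI[of _ "c - 1"] exI[of _ "[1]"] exI[of _ "m12 G' - 1"]) auto
    qed
  qed
qed

lemma expand_unimodular:
  assumes "unimodular G" "m21 G \<noteq> 0"
  obtains c cs t where "\<forall>d\<in>set cs. d \<ge> 1"
    "G \<approx> shear c * swap * prod_list (map quot cs) * shear t"
proof (cases "m21 G > 0")
  case True
  then show thesis
    using expand_unimodular_pos[OF assms(1)] that by (metis sign_eq_refl)
next
  case False
  then have "unimodular (- G)" "m21 (- G) > 0"
    using assms by simp_all
  then obtain c cs t where "\<forall>d\<in>set cs. d \<ge> 1"
    "- G = shear c * swap * prod_list (map quot cs) * shear t"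
    using expand_unimodular_pos by blast
  then show thesis
    by (intro that[of cs c t]) (auto simp: sign_eq_def dest: minus_equation_iff[THEN iffD1])
qed

section \<open>Words without degenerate letters\<close>

definition eventually_positive :: "int poly \<Rightarrow> bool" where
  "eventually_positive P \<longleftrightarrow> (\<forall>\<^sub>F n in sequentially. poly P (int n) > 0)"

text \<open>
  By Horner's scheme: the value of \<open>Q\<close> is at least 1 from some point on, so \<open>a + n * Q n\<close> is at least
  \<open>a + n\<close>.
\<close>

lemma eventually_positive_lead_coeff: "lead_coeff P > 0 \<Longrightarrow> eventually_positive P"
proof (induction P)
  case (pCons a Q)
  show ?case
  proof (cases "Q = 0")
    case True
    then show ?thesis using pCons.prems by (simp add: eventually_positive_def)
  next
    case False
    then have "\<forall>\<^sub>F n in sequentially. poly Q (int n) > 0"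
      using pCons by (simp add: eventually_positive_def)
    then have "\<forall>\<^sub>F n in sequentially. poly (pCons a Q) (int n) > 0"
      using eventually_gt_at_top[of "nat \<bar>a\<bar>"]
    proof eventually_elim
      case (elim n)
      have "int n * 1 \<le> int n * poly Q (int n)"
        using elim by (intro mult_left_mono) auto
      moreover have "\<bar>a\<bar> < int n"
        using elim(2) by linarith
      ultimately have "0 < a + int n * poly Q (int n)"
        by linarith
      then show ?case by simp
    qed
    then show ?thesis by (simp add: eventually_positive_def)
  qed
qed simp

lemma eventually_positive_add_const:
  assumes "degree P > 0" "lead_coeff P > 0"
  shows "eventually_positive (P + [:c:])"
proof -
  have "lead_coeff (P + [:c:]) = lead_coeff P"
    using lead_coeff_add_le[of "[:c:]" P] assms(1) by (simp only: add.commute degree_pCons_0)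
  then show ?thesis
    using assms(2) by (intro eventually_positive_lead_coeff) simp
qed

definition quot_word_at :: "int poly list \<Rightarrow> nat \<Rightarrow> mat2" where
  "quot_word_at qs n = prod_list (map (\<lambda>Q. quot (poly Q (int n))) qs)"

lemma flip_flip [simp]: "flip * flip = 1"
  by (rule mat2_eqI) simp_all

text \<open>
  Multiplying by \<open>shear t * swap\<close> on the right turns the final shear of \<open>F n\<close> into a partial quotient
  (\<open>shear_swap\<close>), and the leading \<open>shear c * swap\<close> on the other side is what a preceding factor
  needs for its own final shear. So expansions compose, and for \<open>c = t\<close> they express that \<open>F\<close> is
  conjugate to a product of partial quotients.
\<close>

definition has_expansion :: "(nat \<Rightarrow> mat2) \<Rightarrow> int \<Rightarrow> int \<Rightarrow> bool" where
  "has_expansion F c t \<longleftrightarrow> (\<exists>qs. qs \<noteq> [] \<and> (\<forall>Q\<in>set qs. eventually_positive Q) \<and>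
     (\<forall>n. F n * shear t * swap \<approx> shear c * swap * quot_word_at qs n))"

lemma has_expansion_mult:
  assumes "has_expansion F c d" "has_expansion F' d t"
  shows "has_expansion (\<lambda>n. F n * F' n) c t"
proof -
  obtain qs where qs: "qs \<noteq> []" "\<forall>Q\<in>set qs. eventually_positive Q"
    and F: "\<And>n. F n * shear d * swap \<approx> shear c * swap * quot_word_at qs n"
    using assms(1) unfolding has_expansion_def by (elim exE conjE) simp
  obtain qs' where qs': "qs' \<noteq> []" "\<forall>Q\<in>set qs'. eventually_positive Q"
    and F': "\<And>n. F' n * shear t * swap \<approx> shear d * swap * quot_word_at qs' n"
    using assms(2) unfolding has_expansion_def by (elim exE conjE) simp
  have "F n * F' n * shear t * swap \<approx> shear c * swap * quot_word_at (qs @ qs') n" for n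
  proof -
    have "F n * F' n * shear t * swap = F n * (F' n * shear t * swap)"
      by (simp add: mult.assoc)
    also have "\<dots> \<approx> F n * (shear d * swap * quot_word_at qs' n)"
      by (rule sign_eq_mult[OF sign_eq_refl F'])
    also have "\<dots> = (F n * shear d * swap) * quot_word_at qs' n"
      by (simp add: mult.assoc)
    also have "\<dots> \<approx> (shear c * swap * quot_word_at qs n) * quot_word_at qs' n"
      by (rule sign_eq_mult[OF F sign_eq_refl])
    also have "\<dots> = shear c * swap * quot_word_at (qs @ qs') n"
      by (simp add: quot_word_at_def mult.assoc)
    finally show ?thesis .
  qed
  then show ?thesis
    unfolding has_expansion_def using qs qs' by (intro exI[of _ "qs @ qs'"]) auto
qed

text \<open>
  The identity \<open>shear (- p) = flip * shear p * flip\<close> makes the polynomials eventually positive at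
  the cost of flips, which are absorbed into the neighbouring matrix parts.
\<close>

definition orientation :: "int poly \<Rightarrow> mat2" where
  "orientation P = (if lead_coeff P > 0 then 1 else flip)"

lemma orientation_cases: "orientation P \<in> {1, flip}"
  by (simp add: orientation_def)

lemma orientation_sel:
  "orientation P * orientation P = 1" "unimodular (orientation P)"
  "m21 (orientation P) = 0" "m11 (orientation P) = 1"
  by (simp_all add: orientation_def)

text \<open>
  The continued fraction of the matrix part ends with a shear by a constant. This constant and the one
  that comes from the right are added to the non-constant polynomial, so they do not affect its
  eventual positivity, whatever their signs are.
\<close>

lemma letter_has_expansion:
  assumes G: "unimodular G" "m21 G \<noteq> 0" and P: "degree P > 0" and D: "D \<in> {1, flip}"
  obtains c where "\<And>t. has_expansion (\<lambda>n. D * letter_at n (G, P) * orientation P) c t"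
proof -
  define e where "e = orientation P"
  define P' where "P' = (if lead_coeff P > 0 then P else - P)"
  have "lead_coeff P \<noteq> 0"
    using P by auto
  then have lc: "lead_coeff P > 0 \<or> lead_coeff P < 0"
    by linarith
  have P': "degree P' > 0" "lead_coeff P' > 0"
    using P lc by (auto simp: P'_def)
  have shear_P: "shear (poly P x) * e = e * shear (poly P' x)" for x
    by (rule mat2_eqI) (simp_all add: e_def P'_def orientation_def)
  have "unimodular (D * G * e)" "m21 (D * G * e) \<noteq> 0"
    using D G by (auto simp: e_def orientation_sel)
  then obtain c cs t where cs: "\<forall>d\<in>set cs. d \<ge> 1"
    and DGe: "D * G * e \<approx> shear c * swap * prod_list (map quot cs) * shear t"
    by (rule expand_unimodular)
  have "has_expansion (\<lambda>n. D * letter_at n (G, P) * e) c t0" for t0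
  proof -
    define qs where "qs = map (\<lambda>d. [:d:]) cs @ [P' + [:t + t0:]]"
    have "D * letter_at n (G, P) * e * shear t0 * swap \<approx> shear c * swap * quot_word_at qs n" for n
    proof -
      define x where "x = poly P' (int n)"
      have "D * letter_at n (G, P) * e = D * G * (shear (poly P (int n)) * e)"
        by (simp add: letter_at_def mult.assoc)
      then have "D * letter_at n (G, P) * e * shear t0 * swap = (D * G * e) * (shear x * shear t0 * swap)"
        unfolding shear_P x_def by (simp add: mult.assoc)
      also have "\<dots> \<approx> (shear c * swap * prod_list (map quot cs) * shear t) * (shear x * shear t0 * swap)"
        by (rule sign_eq_mult[OF DGe sign_eq_refl])
      also have "\<dots> = shear c * swap * (prod_list (map quot cs) * (shear (t + x + t0) * swap))"
        by (simp add: shear_add mult.assoc)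
      also have "\<dots> = shear c * swap * quot_word_at qs n"
        unfolding shear_swap by (simp add: quot_word_at_def qs_def x_def o_def add_ac)
      finally show ?thesis .
    qed
    moreover have "\<forall>Q\<in>set qs. eventually_positive Q"
      using cs eventually_positive_add_const[OF P']
      by (auto simp: qs_def eventually_positive_def)
    ultimately show ?thesis
      unfolding has_expansion_def by (intro exI[of _ qs]) (simp add: qs_def)
  qed
  then show thesis
    unfolding e_def by (rule that)
qed

text \<open>
  Two neighbouring letters have to agree on the flip between them. The one on the right end is dictated
  by the last letter, whereas the one on the left end is arbitrary. In particular both ends can be
  chosen equal, which amounts to a conjugation.
\<close>

lemma word_has_expansion:
  assumes "w \<noteq> []"
    and "\<And>l. l \<in> set w \<Longrightarrow> unimodular (fst l) \<and> m21 (fst l) \<noteq> 0 \<and> degree (snd l) > 0"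
  obtains E where "E \<in> {1, flip}"
    "\<And>D. D \<in> {1, flip} \<Longrightarrow> \<exists>c. \<forall>t. has_expansion (\<lambda>n. D * word_at w n * E) c t"
  using assms
proof (induction w arbitrary: thesis rule: list_nonempty_induct)
  case (single l)
  obtain G P where l: "l = (G, P)" by (cases l)
  have GP: "unimodular G" "m21 G \<noteq> 0" "degree P > 0"
    using single.prems(2)[of l] by (simp_all add: l)
  show ?case
  proof (rule single.prems(1)[OF orientation_cases[of P]])
    fix D assume "D \<in> {1, flip}"
    from letter_has_expansion[OF GP this]
    show "\<exists>c. \<forall>t. has_expansion (\<lambda>n. D * word_at [l] n * orientation P) c t"
      by (simp add: l) metis
  qed
next
  case (cons l w)
  obtain G P where l: "l = (G, P)" by (cases l)
  have GP: "unimodular G" "m21 G \<noteq> 0" "degree P > 0"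
    using cons.prems(2)[of l] by (simp_all add: l)
  obtain E where E: "E \<in> {1, flip}"
    and IH: "\<And>D. D \<in> {1, flip} \<Longrightarrow> \<exists>c. \<forall>t. has_expansion (\<lambda>n. D * word_at w n * E) c t"
    using cons.IH cons.prems(2) by (metis list.set_intros(2))
  obtain d where d: "\<And>t. has_expansion (\<lambda>n. orientation P * word_at w n * E) d t"
    using IH[OF orientation_cases] by metis
  show ?case
  proof (rule cons.prems(1)[OF E])
    fix D assume "D \<in> {1, flip}"
    from letter_has_expansion[OF GP this]
    obtain c where c: "\<And>t. has_expansion (\<lambda>n. D * letter_at n (G, P) * orientation P) c t"
      by metis
    have "D * word_at (l # w) n * E =
        (D * letter_at n (G, P) * orientation P) * (orientation P * word_at w n * E)" for n
      by (simp add: l mult.assoc orientation_sel flip: mult.assoc[of "orientation P" "orientation P"])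
    then show "\<exists>c. \<forall>t. has_expansion (\<lambda>n. D * word_at (l # w) n * E) c t"
      using has_expansion_mult[OF c d] by auto
  qed
qed

section \<open>Simple interlaced continued fractions\<close>

definition moebius_of_simple_cf :: "real \<Rightarrow> bool" where
  "moebius_of_simple_cf \<alpha> \<longleftrightarrow> (\<exists>U. mdet U \<noteq> 0 \<and>
     (\<exists>\<beta> a b. simple_interlaced \<beta> a b \<and> cf_converges_to a b (moebius U \<alpha>)))"

lemma moebius_of_simple_cf_moebius:
  assumes "\<alpha> \<notin> \<rat>" "mdet V \<noteq> 0" "moebius_of_simple_cf (moebius V \<alpha>)"
  shows "moebius_of_simple_cf \<alpha>"
proof -
  obtain U \<beta> a b where "mdet U \<noteq> 0" "simple_interlaced \<beta> a b"
    "cf_converges_to a b (moebius U (moebius V \<alpha>))"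
    using assms(3) by (auto simp: moebius_of_simple_cf_def)
  then show ?thesis
    using assms(1,2) unfolding moebius_of_simple_cf_def
    by (intro exI[of _ "U * V"]) (auto simp: moebius_mult)
qed

text \<open>
  After dropping finitely many periods all partial quotients are positive, so the simple continued
  fraction converges. Its limit is determined by the convergents at the period ends, which are the
  given product.
\<close>

lemma quot_word_simple_cf:
  assumes irr: "\<alpha> \<notin> \<rat>" and rep: "represents (quot_word_at qs) \<alpha>"
    and qs: "qs \<noteq> []" "\<And>Q. Q \<in> set qs \<Longrightarrow> eventually_positive Q"
  shows "moebius_of_simple_cf \<alpha>"
proof -
  have "\<forall>\<^sub>F n in sequentially. \<forall>Q\<in>set qs. poly Q (int n) > 0"
    using qs(2) by (intro eventually_ball_finite) (auto simp: eventually_positive_def)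
  then obtain m where m: "\<And>n Q. n \<ge> m \<Longrightarrow> Q \<in> set qs \<Longrightarrow> poly Q (int n) > 0"
    by (auto simp: eventually_sequentially)
  define \<beta> where "\<beta> = length qs"
  have \<beta>: "\<beta> > 0" using qs(1) by (simp add: \<beta>_def)
  define a where "a j = poly (qs ! ((j - 1) mod \<beta>)) (int (m + (j - 1) div \<beta>))" for j
  define b :: "nat \<Rightarrow> int" where "b j = 1" for j
  have a_pos: "a j \<ge> 1" for j
  proof -
    have "poly (qs ! ((j - 1) mod \<beta>)) (int (m + (j - 1) div \<beta>)) > 0"
      using \<beta> by (intro m) (simp_all add: \<beta>_def)
    then show ?thesis by (simp add: a_def)
  qed
  have a_block: "a (Suc (n * \<beta> + i)) = poly (qs ! i) (int (m + n))" if "i < \<beta>" for n i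
    using that by (simp add: a_def)
  have simple: "simple_interlaced \<beta> a b"
    unfolding simple_interlaced_def signed_interlaced_def
  proof (intro conjI exI ballI allI impI)
    fix n i :: nat assume n: "1 \<le> n" and i: "i \<in> {1..\<beta>}"
    have "a ((n - 1) * \<beta> + i) = a (Suc ((n - 1) * \<beta> + (i - 1)))"
      using i by simp
    also have "\<dots> = poly (qs ! (i - 1)) (int (m + (n - 1)))"
      using i by (intro a_block) auto
    also have "\<dots> = poly (pcompose (qs ! (i - 1)) [:int m - 1, 1:]) (int n)"
      using n by (simp add: poly_pcompose of_nat_diff algebra_simps)
    finally show "a ((n - 1) * \<beta> + i) = poly (pcompose (qs ! (i - 1)) [:int m - 1, 1:]) (int n)" .
    show "b ((n - 1) * \<beta> + i) = (\<lambda>_. 1) i"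
      by (simp add: b_def)
  next
    fix j show "0 < a j" using a_pos[of j] by simp
  qed (use \<beta> in \<open>simp_all add: b_def\<close>)
  obtain L where L: "cf_converges_to a b L"
    using simple_cf_converges[of a b] a_pos by (auto simp: b_def)
  have mat: "convergent_matrix a b (N * \<beta>) = swap * mprod (\<lambda>n. quot_word_at qs (m + n)) N" for N
  proof -
    have "prod_list (map (\<lambda>i. quot (a (Suc (n * \<beta> + i)))) [0..<\<beta>]) = quot_word_at qs (m + n)" for n
    proof -
      have "map (\<lambda>i. quot (a (Suc (n * \<beta> + i)))) [0..<\<beta>] = map (\<lambda>Q. quot (poly Q (int (m + n)))) qs"
        by (rule nth_equalityI) (simp_all add: \<beta>_def a_block[unfolded \<beta>_def])
      then show ?thesis by (simp only: quot_word_at_def)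
    qed
    then have "mprod (\<lambda>j. quot (a (Suc j))) (N * \<beta>) = mprod (\<lambda>n. quot_word_at qs (m + n)) N"
      by (simp add: mprod_blocks)
    then show ?thesis
      by (simp add: convergent_matrix_eq b_def flip: quot_def)
  qed
  have "column_tends (\<lambda>N. convergent_matrix a b (N * \<beta>)) L"
    using column_tends_subseq[of "convergent_matrix a b" L "\<lambda>N. N * \<beta>"] L \<beta>
    by (simp add: cf_converges_to_iff strict_mono_def)
  then have lim: "column_tends (\<lambda>N. swap * mprod (\<lambda>n. quot_word_at qs (m + n)) N) L"
    by (simp add: mat)
  obtain U where U: "mdet U \<noteq> 0" "column_tends (mprod (\<lambda>n. quot_word_at qs (m + n))) (moebius U \<alpha>)"
    using represents_shift[OF irr rep, of m] by (auto simp: represents_def)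
  have "column_tends (\<lambda>N. swap * mprod (\<lambda>n. quot_word_at qs (m + n)) N) (moebius swap (moebius U \<alpha>))"
    by (intro column_tends_left_irrational moebius_irrational irr U unimodular_nonzero) simp
  then have "L = moebius swap (moebius U \<alpha>)"
    using lim by (rule column_tends_unique[rotated])
  then have "L = moebius (swap * U) \<alpha>"
    using irr U by (simp add: moebius_mult)
  then show ?thesis
    using simple L U unimodular_nonzero[OF unimodular_swap] unfolding moebius_of_simple_cf_def
    by (intro exI[of _ "swap * U"] conjI exI[of _ \<beta>] exI[of _ a] exI[of _ b]) simp_all
qed

text \<open>
  The purely periodic simple continued fraction with partial quotients \<open>1, s - 2\<close> has a value \<open>L\<close>
  with \<open>L\<^sup>2 + (s - 2) * L - (s - 2) = 0\<close>. Substituting \<open>L = 1 - z\<close> turns this into the equation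
  \<open>z\<^sup>2 - s * z + 1 = 0\<close> whose roots are \<open>y\<close> and \<open>1 / y\<close>, so \<open>L\<close> is a Moebius transform of \<open>y\<close> in
  either case.
\<close>

lemma quadratic_moebius_of_simple_cf:
  fixes y :: real and s :: int
  assumes irr: "y \<notin> \<rat>" and s: "s \<ge> 3" and eq: "y^2 - of_int s * y + 1 = 0"
  shows "moebius_of_simple_cf y"
proof -
  define a :: "nat \<Rightarrow> int" where "a j = (if odd j then 1 else s - 2)" for j
  define b :: "nat \<Rightarrow> int" where "b j = 1" for j
  define W where "W = quot 1 * quot (s - 2)"
  have a_pos: "a j \<ge> 1" for j
    using s by (simp add: a_def)
  obtain L where L0: "L \<ge> 0" and L: "cf_converges_to a b L"
    using simple_cf_converges[of a b] a_pos by (auto simp: b_def)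
  have simple: "simple_interlaced 2 a b"
    unfolding simple_interlaced_def signed_interlaced_def
  proof (intro conjI exI ballI allI impI)
    fix n i :: nat assume n: "1 \<le> n" and i: "i \<in> {1..2}"
    then show "a ((n - 1) * 2 + i) = poly ((\<lambda>i. [:a i:]) i) (int n)"
      by (simp add: a_def)
    show "b ((n - 1) * 2 + i) = (\<lambda>_. 1) i"
      by (simp add: b_def)
  next
    fix j show "0 < a j" using a_pos[of j] by simp
  qed (simp_all add: b_def)
  have blocks: "mprod (\<lambda>j. Mat (a (Suc j)) 1 (b (Suc j)) 0) (N * 2) = mprod (\<lambda>_. W) N" for N
    by (simp add: mprod_blocks upt_rec a_def b_def W_def flip: quot_def)
  have tends: "column_tends (\<lambda>N. convergent_matrix a b (N * 2)) L"
    using column_tends_subseq[of "convergent_matrix a b" L "\<lambda>N. N * 2"] L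
    by (simp add: cf_converges_to_iff strict_mono_def)
  then have "column_tends (\<lambda>N. convergent_matrix a b (Suc N * 2)) L"
    using column_tends_subseq[OF tends, of Suc] by (simp add: strict_mono_def)
  moreover have "convergent_matrix a b (Suc N * 2) = swap * W * swap * convergent_matrix a b (N * 2)" for N
  proof -
    have "swap * swap = 1"
      by (rule mat2_eqI) simp_all
    then show ?thesis
      unfolding convergent_matrix_eq blocks mprod_const_commute
      by (simp add: mult.assoc flip: mult.assoc[of swap swap])
  qed
  ultimately have "column_tends (\<lambda>N. swap * W * swap * convergent_matrix a b (N * 2)) L"
    by simp
  moreover have den: "of_int (m21 (swap * W * swap)) * L + of_int (m22 (swap * W * swap)) \<noteq> 0"
    using L0 s by (simp add: W_def)
  ultimately have fixed: "moebius (swap * W * swap) L = L"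
    using column_tends_unique[OF column_tends_left[OF tends den]] by simp
  have "L + of_int s - 1 \<noteq> 0"
    using L0 s by simp
  moreover have "(L + of_int s - 2) / (L + of_int s - 1) = L"
    using fixed by (simp add: moebius_def W_def algebra_simps)
  ultimately have quad: "L^2 + (of_int s - 2) * L - (of_int s - 2) = 0"
    by (simp add: field_simps power2_eq_square)
  have y0: "y \<noteq> 0"
    using irr by auto
  \<comment> \<open>The left-hand side is \<open>y * (L - (1 - y)) * (L - (1 - 1 / y))\<close>.\<close>
  have "(L - (1 - y)) * (y * L - (y - 1)) = y * (L^2 + (of_int s - 2) * L - (of_int s - 2)) +
      (L - 1) * (y^2 - of_int s * y + 1)"
    by (simp add: algebra_simps power2_eq_square)
  also have "\<dots> = 0"
    by (simp add: quad eq)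
  finally have "L - (1 - y) = 0 \<or> y * L - (y - 1) = 0"
    by (simp only: mult_eq_0_iff)
  then consider "L = 1 - y" | "L = (y - 1) / y"
    using y0 by (auto simp: field_simps)
  then show ?thesis
  proof cases
    case 1
    then have "L = moebius (Mat (- 1) 1 0 1) y"
      by (simp add: moebius_def)
    then show ?thesis
      using simple L unfolding moebius_of_simple_cf_def
      by (intro exI[of _ "Mat (- 1) 1 0 1"] conjI exI[of _ 2] exI[of _ a] exI[of _ b]) (simp_all add: mdet_def)
  next
    case 2
    then have "L = moebius (Mat 1 (- 1) 1 0) y"
      by (simp add: moebius_def)
    then show ?thesis
      using simple L unfolding moebius_of_simple_cf_def
      by (intro exI[of _ "Mat 1 (- 1) 1 0"] conjI exI[of _ 2] exI[of _ a] exI[of _ b]) (simp_all add: mdet_def)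
  qed
qed

text \<open>
  The limit is a fixed point of \<open>K = M\<^sup>2\<close>, which has determinant 1. The corresponding eigenvalue
  \<open>x\<close> of \<open>K\<close> is a Moebius transform of the fixed point and a root of \<open>x\<^sup>2 - t * x + 1\<close>, where \<open>t\<close> is
  the trace of \<open>K\<close>. Being real and irrational it forces \<open>\<bar>t\<bar> \<ge> 3\<close>. Passing to the eigenvalue in this
  way avoids Lagrange's theorem on periodic continued fractions.
\<close>

lemma constant_word_simple_cf:
  assumes irr: "\<alpha> \<notin> \<rat>" and rep: "represents (\<lambda>_. M) \<alpha>"
  shows "moebius_of_simple_cf \<alpha>"
proof -
  obtain U where U: "mdet U \<noteq> 0" and lim_M: "column_tends (mprod (\<lambda>_. M)) (moebius U \<alpha>)"
    and uM: "unimodular M"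
    using rep by (auto simp: represents_def)
  define \<gamma> where "\<gamma> = moebius U \<alpha>"
  have irr_\<gamma>: "\<gamma> \<notin> \<rat>"
    unfolding \<gamma>_def using irr U by (rule moebius_irrational)
  define K where "K = M * M"
  have detK: "mdet K = 1"
    using uM by (auto simp: K_def unimodular_def abs_if split: if_splits)
  have "mprod (\<lambda>_. M) (N * 2) = mprod (\<lambda>_. K) N" for N
    by (simp add: mprod_blocks upt_rec K_def)
  then have lim: "column_tends (mprod (\<lambda>_. K)) \<gamma>"
    using column_tends_subseq[OF lim_M, of "\<lambda>N. N * 2"] by (simp add: strict_mono_def \<gamma>_def)
  then have "column_tends (\<lambda>N. mprod (\<lambda>_. K) (Suc N)) \<gamma>"
    using column_tends_subseq[OF lim, of Suc] by (simp add: strict_mono_def)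
  then have "column_tends (\<lambda>N. K * mprod (\<lambda>_. K) N) \<gamma>"
    by (simp only: mprod_const_commute)
  moreover have "column_tends (\<lambda>N. K * mprod (\<lambda>_. K) N) (moebius K \<gamma>)"
    using lim irr_\<gamma> by (rule column_tends_left_irrational) (simp add: detK)
  ultimately have fixed: "moebius K \<gamma> = \<gamma>"
    by (rule column_tends_unique[rotated])
  obtain a b c d where K: "K = Mat a b c d" by (cases K)
  have det: "a * d - b * c = 1"
    using detK by (simp add: K mdet_def)
  have c: "c \<noteq> 0"
  proof
    assume "c = 0"
    then have "m21 (mprod (\<lambda>_. K) N) = 0" for N
      by (induction N) (simp_all add: K)
    then show False
      using lim by (simp add: column_tends_def)
  qed
  define x where "x = of_int c * \<gamma> + of_int d"
  define t where "t = a + d"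
  have x_moebius: "x = moebius (Mat c d 0 1) \<gamma>" and det_cd: "mdet (Mat c d 0 1) \<noteq> 0"
    using c by (simp_all add: moebius_def x_def mdet_def)
  have irr_x: "x \<notin> \<rat>"
    unfolding x_moebius using irr_\<gamma> det_cd by (rule moebius_irrational)
  have "x \<noteq> 0"
    using irr_x by auto
  then have "\<gamma> * x = of_int a * \<gamma> + of_int b"
    using fixed by (simp add: moebius_def K x_def field_simps)
  then have root: "x^2 - of_int t * x + 1 = 0"
  proof -
    assume eq: "\<gamma> * x = of_int a * \<gamma> + of_int b"
    have "(of_int a * of_int d - of_int b * of_int c :: real) = 1"
      by (metis det of_int_1 of_int_diff of_int_mult)
    moreover have "x^2 - of_int t * x + 1 = of_int c * (\<gamma> * x - of_int a * \<gamma> - of_int b) +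
        (1 - (of_int a * of_int d - of_int b * of_int c))"
      by (simp add: x_def t_def power2_eq_square algebra_simps)
    ultimately show ?thesis by (simp add: eq)
  qed
  have "\<bar>t\<bar> \<ge> 3"
  proof (rule ccontr)
    assume "\<not> \<bar>t\<bar> \<ge> 3"
    then have "\<bar>t\<bar> \<le> 2" by simp
    then have "\<bar>of_int t\<bar> \<le> (2 :: real)" by linarith
    then have t4: "(of_int t :: real)^2 \<le> 4"
      using abs_le_square_iff[of "of_int t" "2 :: real"] by simp
    \<comment> \<open>For \<open>\<bar>t\<bar> \<le> 2\<close> the discriminant \<open>t\<^sup>2 - 4\<close> is not positive, so a real root is the rational \<open>t / 2\<close>.\<close>
    have "(2 * x - of_int t)^2 = of_int t^2 - 4 + 4 * (x^2 - of_int t * x + 1)"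
      by (simp add: power2_eq_square algebra_simps)
    then have "(2 * x - of_int t)^2 \<le> 0"
      using t4 root by simp
    then have "x = of_int t / 2" by simp
    then have "x \<in> \<rat>"
      by (metis Rats_divide Rats_of_int Rats_number_of)
    then show False using irr_x by simp
  qed
  then consider "t \<ge> 3" | "- t \<ge> 3" by linarith
  then have "moebius_of_simple_cf x"
  proof cases
    case 1
    then show ?thesis
      using quadratic_moebius_of_simple_cf irr_x root by blast
  next
    case 2
    have "- x \<notin> \<rat>" using irr_x by simp
    then have "moebius_of_simple_cf (- x)"
      using 2 root by (intro quadratic_moebius_of_simple_cf[of _ "- t"]) simp_all
    moreover have "- x = moebius (Mat (- 1) 0 0 1) x"
      by (simp add: moebius_def)
    ultimately show ?thesis
      using moebius_of_simple_cf_moebius[OF irr_x, of "Mat (- 1) 0 0 1"] by (simp add: mdet_def)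
  qed
  then have "moebius_of_simple_cf \<gamma>"
    unfolding x_moebius by (rule moebius_of_simple_cf_moebius[OF irr_\<gamma> det_cd])
  then show ?thesis
    unfolding \<gamma>_def by (rule moebius_of_simple_cf_moebius[OF irr U])
qed

text \<open>
  Degenerate letters are removed as long as the word has at least two letters. A single degenerate
  letter either is constant or has upper triangular values.
\<close>

lemma word_simple_cf:
  assumes irr: "\<alpha> \<notin> \<rat>" and w: "represents (word_at w) \<alpha>" "unimodular_word w"
  shows "moebius_of_simple_cf \<alpha>"
  using w
proof (induction "length w" arbitrary: w rule: less_induct)
  case less
  show ?case
  proof (cases "\<exists>l\<in>set w. degree (snd l) = 0 \<or> m21 (fst l) = 0")
    case True
    then obtain l where l: "l \<in> set w" "degree (snd l) = 0 \<or> m21 (fst l) = 0" by blast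
    show ?thesis
    proof (cases "length w \<ge> 2")
      case True
      then obtain w' where w': "represents (word_at w') \<alpha>" "unimodular_word w'" "length w' < length w"
        using shorten_word[OF irr less.prems l] by metis
      show ?thesis
        using less.hyps[OF w'(3,1,2)] .
    next
      case False
      then have w: "w = [l]"
        using l(1) by (cases w; cases "tl w") auto
      show ?thesis
      proof (cases "degree (snd l) = 0")
        case True
        then have "word_at w = (\<lambda>_. letter_at 0 l)"
          by (simp add: w fun_eq_iff letter_at_def poly_degree_0)
        then show ?thesis
          using constant_word_simple_cf[OF irr] less.prems(1) by simp
      next
        case False
        then have "m21 (word_at w n) = 0" for n
          using l(2) by (simp add: w letter_at_def)
        then have False
          by (rule represents_not_upper_triangular[OF less.prems(1)])
        then show ?thesis ..
      qed
    qed
  next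
    case False
    then have good: "\<And>l. l \<in> set w \<Longrightarrow> unimodular (fst l) \<and> m21 (fst l) \<noteq> 0 \<and> degree (snd l) > 0"
      using less.prems(2) by (auto simp: unimodular_word_def)
    have "w \<noteq> []"
    proof
      assume "w = []"
      then show False
        by (intro represents_not_upper_triangular[OF less.prems(1)]) simp
    qed
    from word_has_expansion[OF this good] obtain E where E: "E \<in> {1, flip}"
      and expansion: "\<And>D. D \<in> {1, flip} \<Longrightarrow> \<exists>c. \<forall>t. has_expansion (\<lambda>n. D * word_at w n * E) c t"
      by metis
    \<comment> \<open>Choosing the left flip and the right shear equal to their counterparts closes the period.\<close>
    obtain c where "has_expansion (\<lambda>n. E * word_at w n * E) c c"
      using expansion[OF E] by metis
    then obtain qs where qs: "qs \<noteq> []" "\<forall>Q\<in>set qs. eventually_positive Q"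
      and eq: "\<And>n. E * word_at w n * E * shear c * swap \<approx> shear c * swap * quot_word_at qs n"
      unfolding has_expansion_def by (elim exE conjE) simp
    have E2: "E * E = 1" and uE: "unimodular E"
      using E by auto
    have "represents (quot_word_at qs) \<alpha>"
    proof (rule represents_conjugate[OF irr less.prems(1)])
      show "unimodular (quot_word_at qs n)" for n
        unfolding quot_word_at_def by (induction qs) simp_all
      show "unimodular (E * shear c * swap)"
        using uE by simp
      fix n
      have "word_at w n * ((E * shear c * swap) * shear 0) = E * E * word_at w n * E * shear c * swap"
        by (simp add: E2 mult.assoc)
      also have "\<dots> = E * (E * word_at w n * E * shear c * swap)"
        by (simp add: mult.assoc)
      also have "\<dots> \<approx> E * (shear c * swap * quot_word_at qs n)"
        by (intro sign_eq_mult eq sign_eq_refl)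
      also have "\<dots> = ((E * shear c * swap) * shear 0) * quot_word_at qs n"
        by (simp add: mult.assoc)
      finally show "word_at w n * ((E * shear c * swap) * shear ((\<lambda>_. 0) (Suc n))) \<approx>
          ((E * shear c * swap) * shear ((\<lambda>_. 0) n)) * quot_word_at qs n" by simp
    qed
    then show ?thesis
      using qs by (intro quot_word_simple_cf[OF irr, of qs]) simp_all
  qed
qed

text \<open>
  Each step of the continued fraction with \<open>b = \<plusminus>1\<close> is a shear by \<open>b * a\<close> followed by a constant
  matrix, which gives two letters. Periods of words are numbered from 0, hence the substitution of
  \<open>1 + x\<close> into the polynomials.
\<close>

lemma signed_interlaced_represented:
  assumes "signed_interlaced \<beta> a b" "cf_converges_to a b \<alpha>" and irr: "\<alpha> \<notin> \<rat>"
  obtains w where "represents (word_at w) \<alpha>" "unimodular_word w"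
proof -
  obtain A B where \<beta>: "\<beta> \<ge> 1" and B: "\<And>i. i \<in> {1..\<beta>} \<Longrightarrow> B i \<in> {1, - 1}"
    and a: "\<And>n i. n \<ge> 1 \<Longrightarrow> i \<in> {1..\<beta>} \<Longrightarrow> a ((n - 1) * \<beta> + i) = poly (A i) (int n)"
    and b: "\<And>n i. n \<ge> 1 \<Longrightarrow> i \<in> {1..\<beta>} \<Longrightarrow> b ((n - 1) * \<beta> + i) = B i"
    using assms(1) unfolding signed_interlaced_def by blast
  define sub where "sub i = [(1, smult (B (Suc i)) (pcompose (A (Suc i)) [:1, 1:])), (Mat 0 1 (B (Suc i)) 0, 0)]" for i
  define w where "w = concat (map sub [0..<\<beta>])"
  define G where "G j = Mat (a (Suc j)) 1 (b (Suc j)) 0" for j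
  have sub: "prod_list (map (letter_at n) (sub i)) = G (n * \<beta> + i)" if i: "i < \<beta>" for n i
  proof -
    have "a (Suc (n * \<beta> + i)) = poly (A (Suc i)) (1 + int n)" "b (Suc (n * \<beta> + i)) = B (Suc i)"
      using a[of "Suc n" "Suc i"] b[of "Suc n" "Suc i"] i by simp_all
    moreover have "B (Suc i) * B (Suc i) = 1"
      using B[of "Suc i"] i by auto
    ultimately show ?thesis
      by (intro mat2_eqI) (simp_all add: sub_def letter_at_def poly_pcompose G_def)
  qed
  have block: "word_at w n = prod_list (map (\<lambda>i. G (n * \<beta> + i)) [0..<\<beta>])" for n
  proof -
    have "prod_list (map (letter_at n) (concat (map sub is))) =
        prod_list (map (\<lambda>i. prod_list (map (letter_at n) (sub i))) is)" for "is"
      by (induction "is") simp_all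
    then have "word_at w n = prod_list (map (\<lambda>i. prod_list (map (letter_at n) (sub i))) [0..<\<beta>])"
      by (simp add: word_at_def w_def)
    also have "map (\<lambda>i. prod_list (map (letter_at n) (sub i))) [0..<\<beta>] = map (\<lambda>i. G (n * \<beta> + i)) [0..<\<beta>]"
      by (simp add: sub)
    finally show ?thesis .
  qed
  have uw: "unimodular_word w"
  proof -
    have "\<bar>B (Suc i)\<bar> = 1" if "i < \<beta>" for i
      using B[of "Suc i"] that by auto
    then show ?thesis
      by (auto simp: unimodular_word_def w_def sub_def unimodular_def mdet_def)
  qed
  have "word_at w = (\<lambda>n. prod_list (map (\<lambda>i. G (n * \<beta> + i)) [0..<\<beta>]))"
    by (rule ext) (rule block)
  then have "convergent_matrix a b (N * \<beta>) = swap * mprod (word_at w) N" for N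
    by (simp add: convergent_matrix_eq mprod_blocks G_def)
  then have lim: "column_tends (\<lambda>N. swap * mprod (word_at w) N) \<alpha>"
    using column_tends_subseq[of "convergent_matrix a b" \<alpha> "\<lambda>N. N * \<beta>"] assms(2) \<beta>
    by (simp add: cf_converges_to_iff strict_mono_def)
  have "swap * (swap * X) = X" for X
    by (rule mat2_eqI) simp_all
  then have "column_tends (mprod (word_at w)) (moebius swap \<alpha>)"
    using column_tends_left_irrational[OF lim irr unimodular_nonzero[OF unimodular_swap]] by simp
  then have "represents (word_at w) \<alpha>"
    using unimodular_word_at[OF uw] unimodular_nonzero[OF unimodular_swap]
    unfolding represents_def by (intro conjI allI exI[of _ swap])
  then show thesis using uw by (rule that)
qed

theorem theorem2:
  fixes \<alpha> :: real and \<beta> :: nat and a b :: "nat \<Rightarrow> int"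
  assumes "\<alpha> \<notin> \<rat>"
    and "signed_interlaced \<beta> a b"
    and "cf_converges_to a b \<alpha>"
  shows "\<exists>p q r s :: int. p * s - q * r \<noteq> 0 \<and>
           (\<exists>(\<beta>' :: nat) (a' :: nat \<Rightarrow> int) (b' :: nat \<Rightarrow> int).
              simple_interlaced \<beta>' a' b' \<and>
              cf_converges_to a' b'
                ((of_int p * \<alpha> + of_int q) / (of_int r * \<alpha> + of_int s)))"
proof -
  obtain w where "represents (word_at w) \<alpha>" "unimodular_word w"
    using signed_interlaced_represented[OF assms(2,3,1)] .
  then have "moebius_of_simple_cf \<alpha>"
    by (rule word_simple_cf[OF assms(1)])
  then obtain U \<beta>' a' b' where "mdet U \<noteq> 0" "simple_interlaced \<beta>' a' b'"
    "cf_converges_to a' b' (moebius U \<alpha>)"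
    unfolding moebius_of_simple_cf_def by blast
  then show ?thesis
    unfolding mdet_def moebius_def
    by (intro exI[of _ "m11 U"] exI[of _ "m12 U"] exI[of _ "m21 U"] exI[of _ "m22 U"] conjI
        exI[of _ \<beta>'] exI[of _ a'] exI[of _ b'])
qed

end
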